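(* Let $k \geq 1$ and let $G$ be a TRVG with $n$ vertices whose vertex set is partitioned into $k$ nonempty independent sets. Then $G$ has at most $2(k-1)n - k(k-1)$ edges.
   Context: A (finite, simple) graph $G$ is a transparent rectangle visibility graph (TRVG) if there is an assignment of a rectangle $R_v$ in the plane to each vertex $v$, where each $R_v$ is a nondegenerate closed rectangle with sides parallel to the coordinate axes and distinct rectangles have disjoint interiors, such that for all distinct vertices $u,v$: $u$ and $v$ are adjacent if and only if there is a horizontal line or a vertical line meeting the interiors of both $R_u$ and $R_v$. *)

theory Defs
  imports "HOL-Analysis.Analysis" "HOL-Library.Disjoint_Sets"
begin

definition simple_graph :: "'a set \<Rightarrow> 'a set set \<Rightarrow> bool" where
  "simple_graph V E \<longleftrightarrow> finite V \<and> (\<forall>e\<in>E. e \<subseteq> V \<and> card e = 2)"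

definition adjacent :: "'a set set \<Rightarrow> 'a \<Rightarrow> 'a \<Rightarrow> bool" where
  "adjacent E u v \<longleftrightarrow> {u, v} \<in> E"

definition independent_set :: "'a set \<Rightarrow> 'a set set \<Rightarrow> 'a set \<Rightarrow> bool" where
  "independent_set V E S \<longleftrightarrow> S \<subseteq> V \<and> (\<forall>u\<in>S. \<forall>v\<in>S. \<not> adjacent E u v)"

definition rectangle :: "(real \<times> real) set \<Rightarrow> bool" where
  "rectangle R \<longleftrightarrow> (\<exists>a b c d. a < b \<and> c < d \<and> R = {a..b} \<times> {c..d})"

definition horizontal_line :: "(real \<times> real) set \<Rightarrow> bool" where
  "horizontal_line L \<longleftrightarrow> (\<exists>c. L = {p. snd p = c})"

definition vertical_line :: "(real \<times> real) set \<Rightarrow> bool" where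
  "vertical_line L \<longleftrightarrow> (\<exists>c. L = {p. fst p = c})"

(* Transparent visibility: other rectangles may lie on L between R and S without blocking it. *)
definition sees :: "(real \<times> real) set \<Rightarrow> (real \<times> real) set \<Rightarrow> bool" where
  "sees R S \<longleftrightarrow> (\<exists>L. (horizontal_line L \<or> vertical_line L) \<and>
     L \<inter> interior R \<noteq> {} \<and> L \<inter> interior S \<noteq> {})"

(* Disjointness is required for distinct vertices, so two vertices never share a rectangle. *)
definition trvg_representation ::
  "'a set \<Rightarrow> 'a set set \<Rightarrow> ('a \<Rightarrow> (real \<times> real) set) \<Rightarrow> bool" where
  "trvg_representation V E R \<longleftrightarrow>
     (\<forall>v\<in>V. rectangle (R v)) \<and>
     (\<forall>u\<in>V. \<forall>v\<in>V. u \<noteq> v \<longrightarrow> interior (R u) \<inter> interior (R v) = {}) \<and>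
     (\<forall>u\<in>V. \<forall>v\<in>V. u \<noteq> v \<longrightarrow> (adjacent E u v \<longleftrightarrow> sees (R u) (R v)))"

definition trvg :: "'a set \<Rightarrow> 'a set set \<Rightarrow> bool" where
  "trvg V E \<longleftrightarrow> simple_graph V E \<and> (\<exists>R. trvg_representation V E R)"

end

theory Submission
  imports Defs
begin

text \<open>Every edge joins two rectangles whose projections to the \<open>x\<close>-axis, or to the \<open>y\<close>-axis,
  overlap, so \<open>E\<close> is covered by two interval graphs, both properly \<open>k\<close>-coloured by the parts.
  Order the intervals of such a graph by their left endpoints. The earlier neighbours of an interval
  \<open>I\<close>, together with \<open>I\<close>, all contain the points just right of the left endpoint of \<open>I\<close>, hence
  form a clique and have different colours. The \<open>i\<close>-th interval (from \<open>0\<close>) therefore has at most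
  \<open>min i (k - 1)\<close> earlier neighbours, and since \<open>n \<ge> k\<close> these bounds sum to
  \<open>(k - 1) n - k (k - 1) / 2\<close>.\<close>

text \<open>When \<open>l < r\<close> on \<open>V\<close>, the strict inequalities say that the open
  intervals meet. Intervals that only touch are not joined, matching visibility through
  interiors.\<close>

definition interval_edges :: "('a \<Rightarrow> real) \<Rightarrow> ('a \<Rightarrow> real) \<Rightarrow> 'a set \<Rightarrow> 'a set set" where
  "interval_edges l r V = {{u, v} | u v. u \<in> V \<and> v \<in> V \<and> u \<noteq> v \<and> l u < r v \<and> l v < r u}"

lemma finite_interval_edges: "finite V \<Longrightarrow> finite (interval_edges l r V)"
  by (rule finite_subset[of _ "Pow V"]) (auto simp: interval_edges_def)

lemma card_interval_edges_le:
  fixes l r :: "'a \<Rightarrow> real" and c :: "'a \<Rightarrow> 'b"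
  assumes "finite V" "finite C" "c ` V \<subseteq> C"
    and "\<And>v. v \<in> V \<Longrightarrow> l v < r v"
    and "\<And>u v. u \<in> V \<Longrightarrow> v \<in> V \<Longrightarrow> u \<noteq> v \<Longrightarrow> l u < r v \<Longrightarrow> l v < r u \<Longrightarrow> c u \<noteq> c v"
  shows "card (interval_edges l r V) \<le> (\<Sum>i<card V. min i (card C - 1))"
  using assms(1,3-)
\<comment> \<open>Intervals are added by increasing left endpoint: \<open>l x\<close> is at least
  every \<open>l y\<close> with \<open>y\<close> in \<open>S\<close>. The rule does not make
  \<open>x\<close> new to \<open>S\<close>, hence the case split.\<close>
proof (induction V rule: finite_ranking_induct[where f = l])
  case empty
  then show ?case by (simp add: interval_edges_def)
next
  case (insert x S)
  show ?case
  proof (cases "x \<in> S")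
    case True
    then show ?thesis using insert by (simp add: insert_absorb)
  next
    case False
    define N where "N = {u \<in> S. l u < r x \<and> l x < r u}"
    have "finite N" using insert.hyps(1) by (simp add: N_def)
    have "interval_edges l r (insert x S) \<subseteq> interval_edges l r S \<union> (\<lambda>u. {u, x}) ` N"
      by (auto simp: interval_edges_def N_def)
    then have "card (interval_edges l r (insert x S))
        \<le> card (interval_edges l r S \<union> (\<lambda>u. {u, x}) ` N)"
      using \<open>finite N\<close> insert.hyps(1) by (intro card_mono) (auto simp: finite_interval_edges)
    also have "\<dots> \<le> card (interval_edges l r S) + card N"
      using card_Un_le card_image_le[OF \<open>finite N\<close>] by (meson add_left_mono le_trans)
    also have "card (interval_edges l r S) \<le> (\<Sum>i<card S. min i (card C - 1))"
      using insert.prems by (intro insert.IH) auto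
    also have "card N \<le> min (card S) (card C - 1)"
    proof -
      have "inj_on c N"
      proof (rule inj_onI, rule ccontr)
        fix u v assume *: "u \<in> N" "v \<in> N" "c u = c v" "u \<noteq> v"
        \<comment> \<open>Here \<open>l u \<le> l x < r v\<close>, and likewise with
          \<open>u\<close> and \<open>v\<close> exchanged.\<close>
        then have "l u < r v" "l v < r u"
          using insert.hyps(2)[of u] insert.hyps(2)[of v] by (auto simp: N_def)
        then show False using * insert.prems(3)[of u v] by (auto simp: N_def)
      qed
      \<comment> \<open>Every member of \<open>N\<close> overlaps \<open>x\<close>, so the colour of
        \<open>x\<close> is lost to \<open>N\<close>; this gives the \<open>- 1\<close>.\<close>
      moreover have "c ` N \<subseteq> C - {c x}"
        using insert.prems(1) insert.prems(3)[of _ x] False by (fastforce simp: N_def)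
      ultimately have "card N \<le> card (C - {c x})"
        using \<open>finite C\<close> by (metis card_inj_on_le finite_Diff)
      moreover have "card N \<le> card S"
        using insert.hyps(1) by (intro card_mono) (auto simp: N_def)
      ultimately show ?thesis using insert.prems(1) by auto
    qed
    finally show ?thesis using False insert.hyps(1) by simp
  qed
qed

text \<open>The first \<open>k\<close> terms are 0, ..., k - 1, and each later term is k - 1.
  Doubling and passing to \<open>int\<close> avoids division and truncated subtraction.\<close>

lemma sum_min_lessThan:
  assumes "1 \<le> k" "k \<le> n"
  shows "2 * int (\<Sum>i<n. min i (k - 1)) = 2 * (int k - 1) * int n - int k * (int k - 1)"
  using assms(2)
proof (induction n rule: dec_induct)
  \<comment> \<open>The bound \<open>k\<close> inside \<open>min\<close> must stay fixed, so the
    inner induction runs over a separate length \<open>m \<le> k\<close>, where the minimum is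
    always \<open>i\<close>.\<close>
  case base
  have "2 * int (\<Sum>i<m. min i (k - 1)) = int m * (int m - 1)" if "m \<le> k" for m
    using that by (induction m) (auto simp: algebra_simps)
  from this[of k] show ?case by (simp add: algebra_simps)
next
  case (step n)
  then show ?case using \<open>1 \<le> k\<close> by (simp add: algebra_simps)
qed

text \<open>A vertical line meets both interiors iff its abscissa lies in both open x-intervals; a
  horizontal line does the same for the y-intervals.\<close>

lemma sees_rectangles_iff:
  fixes a b c d a' b' c' d' :: real
  assumes "a < b" "c < d" "a' < b'" "c' < d'"
  shows "sees ({a..b} \<times> {c..d}) ({a'..b'} \<times> {c'..d'})
    \<longleftrightarrow> a < b' \<and> a' < b \<or> c < d' \<and> c' < d"
proof -
  have overlap: "(\<exists>t. p < t \<and> t < q \<and> p' < t \<and> t < q') \<longleftrightarrow> p < q' \<and> p' < q"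
    if "p < q" "p' < q'" for p q p' q' :: real
  proof
    assume "p < q' \<and> p' < q"
    with that obtain t where "max p p' < t" "t < min q q'"
      using dense[of "max p p'" "min q q'"] by auto
    then show "\<exists>t. p < t \<and> t < q \<and> p' < t \<and> t < q'" by auto
  qed auto
  \<comment> \<open>Density supplies the free coordinate of a point on the line, so that side must
    be nondegenerate.\<close>
  have horizontal: "{z. snd z = t} \<inter> ({p<..<q} \<times> {p'<..<q'}) \<noteq> {} \<longleftrightarrow> p' < t \<and> t < q'"
    if "p < q" for t p q p' q' :: real
    using dense[OF that] by (auto simp: ex_in_conv[symmetric])
  have vertical: "{z. fst z = t} \<inter> ({p<..<q} \<times> {p'<..<q'}) \<noteq> {} \<longleftrightarrow> p < t \<and> t < q"
    if "p' < q'" for t p q p' q' :: real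
    using dense[OF that] by (auto simp: ex_in_conv[symmetric])
  have "sees ({a..b} \<times> {c..d}) ({a'..b'} \<times> {c'..d'}) \<longleftrightarrow>
      (\<exists>t. c < t \<and> t < d \<and> c' < t \<and> t < d') \<or> (\<exists>t. a < t \<and> t < b \<and> a' < t \<and> t < b')"
    unfolding sees_def horizontal_line_def vertical_line_def interior_Times
      interior_atLeastAtMost_real
    using horizontal[OF assms(1)] horizontal[OF assms(3)] vertical[OF assms(2)] vertical[OF assms(4)]
    by metis
  then show ?thesis using overlap[OF assms(1,3)] overlap[OF assms(2,4)] by blast
qed

theorem theorem4:
  fixes V :: "'a set" and E :: "'a set set" and P :: "'a set set" and k n :: nat
  assumes "k \<ge> 1"
    and "trvg V E"
    and "card V = n"
    and "partition_on V P"
    and "card P = k"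
    and "\<forall>S\<in>P. independent_set V E S"
  shows "int (card E) \<le> 2 * (int k - 1) * int n - int k * (int k - 1)"
proof -
  obtain R where graph: "simple_graph V E" and rep: "trvg_representation V E R"
    using assms(2) unfolding trvg_def by blast
  have fin: "finite V" and E: "\<And>e. e \<in> E \<Longrightarrow> e \<subseteq> V \<and> card e = 2"
    using graph by (simp_all add: simple_graph_def)
  have rect: "\<And>v. v \<in> V \<Longrightarrow> rectangle (R v)"
    and adj: "\<And>u v. u \<in> V \<Longrightarrow> v \<in> V \<Longrightarrow> u \<noteq> v \<Longrightarrow> adjacent E u v \<longleftrightarrow> sees (R u) (R v)"
    using rep by (simp_all add: trvg_representation_def)
  have "\<forall>v\<in>V. \<exists>a b c d. a < b \<and> c < d \<and> R v = {a..b} \<times> {c..d}"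
    using rect by (simp add: rectangle_def)
  then obtain a b c d where box:
    "\<And>v. v \<in> V \<Longrightarrow> a v < b v \<and> c v < d v \<and> R v = {a v..b v} \<times> {c v..d v}"
    by metis
  have adj_iff: "adjacent E u v \<longleftrightarrow> a u < b v \<and> a v < b u \<or> c u < d v \<and> c v < d u"
    if "u \<in> V" "v \<in> V" "u \<noteq> v" for u v
    using adj[OF that] box[OF that(1)] box[OF that(2)] by (simp add: sees_rectangles_iff)
  have "\<forall>v\<in>V. \<exists>S\<in>P. v \<in> S" using assms(4) by (auto simp: partition_on_def)
  \<comment> \<open>The part containing a vertex serves as its colour.\<close>
  then obtain f where f: "\<And>v. v \<in> V \<Longrightarrow> f v \<in> P \<and> v \<in> f v" by metis
  have proper: "f u \<noteq> f v" if "u \<in> V" "v \<in> V" "adjacent E u v" for u v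
    using f[OF that(1)] f[OF that(2)] that assms(6) by (metis independent_set_def)
  have "finite P" using assms(4) fin finite_elements by blast
  have "k \<le> n"
  proof -
    \<comment> \<open>Each part is nonempty, and by disjointness it is the colour of any vertex in
      it.\<close>
    have "P \<subseteq> f ` V"
    proof
      fix S assume "S \<in> P"
      moreover then obtain v where "v \<in> S" "v \<in> V"
        using assms(4) by (metis all_not_in_conv partition_onD1 partition_onD3 UnionI)
      ultimately have "S = f v"
        using f[of v] disjointD[OF partition_onD2[OF assms(4)], of S "f v"] by blast
      then show "S \<in> f ` V" using \<open>v \<in> V\<close> by blast
    qed
    then show ?thesis using assms(3,5) surj_card_le[OF fin] by blast
  qed
  have "E \<subseteq> interval_edges a b V \<union> interval_edges c d V"
  proof
    fix e assume "e \<in> E"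
    with E obtain u v where "e = {u, v}" "u \<noteq> v" "u \<in> V" "v \<in> V"
      by (metis card_2_iff insert_subset)
    moreover from this \<open>e \<in> E\<close> adj_iff[of u v]
    have "a u < b v \<and> a v < b u \<or> c u < d v \<and> c v < d u"
      by (simp add: adjacent_def)
    ultimately show "e \<in> interval_edges a b V \<union> interval_edges c d V"
      unfolding interval_edges_def by blast
  qed
  then have "card E \<le> card (interval_edges a b V \<union> interval_edges c d V)"
    using fin by (intro card_mono) (auto simp: finite_interval_edges)
  also have "\<dots> \<le> card (interval_edges a b V) + card (interval_edges c d V)"
    by (rule card_Un_le)
  \<comment> \<open>Overlap on either axis alone already forces adjacency, so \<open>f\<close>
    properly colours both interval graphs.\<close>
  also have "card (interval_edges a b V) \<le> (\<Sum>i<card V. min i (card P - 1))"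
    using f box proper adj_iff
    by (intro card_interval_edges_le[OF fin \<open>finite P\<close>, where c = f]) auto
  also have "card (interval_edges c d V) \<le> (\<Sum>i<card V. min i (card P - 1))"
    using f box proper adj_iff
    by (intro card_interval_edges_le[OF fin \<open>finite P\<close>, where c = f]) auto
  finally have "int (card E) \<le> 2 * int (\<Sum>i<n. min i (k - 1))"
    unfolding assms(3,5) by linarith
  then show ?thesis unfolding sum_min_lessThan[OF assms(1) \<open>k \<le> n\<close>] .
qed

end
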